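(* Let $G$ be a graph and let $V_1,V_2\subseteq V(G)$ be disjoint vertex sets with $|V_1|=|V_2|=m$ such that (1) the induced subgraphs $G[V_1]$ and $G[V_2]$ are empty (have no edges); (2) there exists a graph automorphism $\pi$ of the induced subgraph $G[V_1\cup V_2]$ such that $\pi(V_1)=V_2$, $\pi(V_2)=V_1$, and $\pi^2=\mathrm{id}$. Let $H_1$ and $H_2$ be any two graphs on $m$ vertices, and for $i\in\{1,2\}$ let $\phi_i:V(H_i)\to V_i$ be a bijection. Let $$G_1=G+\phi_1(E(H_1))+\phi_2(E(H_2)),\qquad G_2=G+\pi(\phi_1(E(H_1)))+\pi(\phi_2(E(H_2))),$$ and assume $G_1$ and $G_2$ have no isolated vertices (so that their normalized Laplacians are defined). If $V_1,V_2$ are co-degree cousins in $G$ and $G_1[V_1\cup V_2]$ is a regular graph, then $G_1$ and $G_2$ are cospectral for the normalized Laplacian matrix.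
   Context: Graphs are finite, simple and undirected. $G[U]$ is the subgraph of $G$ induced on $U\subseteq V(G)$; $N(u)$ is the set of neighbors of $u$ in $G$; $u\sim v$ means adjacency in $G$. Gluing: for an injective map $\phi:V(H)\to V(G)$, $\phi(E(H))=\{\phi(x)\phi(y): xy\in E(H)\}$; for a set $F$ of edges on vertices in the domain of $\pi$, $\pi(F)=\{\pi(x)\pi(y):xy\in F\}$; and $G+F$ is the graph obtained from $G$ by adding the edges in $F$. Normalized Laplacian: with $A$ the adjacency matrix, $D$ the diagonal matrix of vertex degrees and $L=D-A$, it is $\mathcal{L}=D^{-1/2}LD^{-1/2}$. Two graphs are cospectral for a matrix if their matrices have the same multiset of eigenvalues. Co-degree cousins: disjoint vertex sets $U,W$ of $G$ are co-degree cousins if (i) $|U|=|W|$; (ii) for all $u_i,u_j\in U$, $w_i,w_j\in W$ and $v\in V(G)\setminus(U\cup W)$, $u_i\sim v$ if and only if $u_j\sim v$, and $w_i\sim v$ if and only if $w_j\sim v$; (iii) $|N(u_i)\setminus W|=|N(w_j)\setminus U|$ for all $u_i\in U$, $w_j\in W$. *)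

theory Defs
  imports
    Complex_Main
    "Graph_Theory.Graph_Theory"
    "Jordan_Normal_Form.Char_Poly"
begin

text \<open>
  Finite simple undirected graphs are the symmetric loop-free digraphs of the locale
  \<^locale>\<open>pair_graph\<close>: an edge $uv$ is the pair of arcs $(u,v)$ and $(v,u)$, so $E(H)$ is
  \<^term>\<open>parcs H\<close>, the degree of a vertex is its \<^const>\<open>out_degree\<close>, and
  the induced subgraph $G[U]$ is \<^const>\<open>induce_subgraph\<close>.
\<close>

definition neighbours :: "('v, 'e) pre_digraph \<Rightarrow> 'v \<Rightarrow> 'v set" where
  "neighbours G u = {v. u \<rightarrow>\<^bsub>G\<^esub> v}"

definition no_isolated_vertex :: "('v, 'e) pre_digraph \<Rightarrow> bool" where
  "no_isolated_vertex G \<longleftrightarrow> (\<forall>u \<in> verts G. neighbours G u \<noteq> {})"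

definition regular_graph :: "('v, 'e) pre_digraph \<Rightarrow> bool" where
  "regular_graph G \<longleftrightarrow> (\<exists>k. \<forall>u \<in> verts G. out_degree G u = k)"

text \<open>
  The values of the function outside the vertex set are irrelevant. A vertex map determines
  the arc map because the graphs considered here have no parallel arcs.
\<close>

definition graph_automorphism :: "('v, 'e) pre_digraph \<Rightarrow> ('v \<Rightarrow> 'v) \<Rightarrow> bool" where
  "graph_automorphism G \<pi> \<longleftrightarrow>
     bij_betw \<pi> (verts G) (verts G) \<and>
     (\<forall>u \<in> verts G. \<forall>v \<in> verts G. u \<rightarrow>\<^bsub>G\<^esub> v \<longleftrightarrow> \<pi> u \<rightarrow>\<^bsub>G\<^esub> \<pi> v)"

definition co_degree_cousins :: "('v, 'e) pre_digraph \<Rightarrow> 'v set \<Rightarrow> 'v set \<Rightarrow> bool" where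
  "co_degree_cousins G U W \<longleftrightarrow>
     U \<subseteq> verts G \<and> W \<subseteq> verts G \<and> U \<inter> W = {} \<and>
     card U = card W \<and>
     (\<forall>v \<in> verts G - (U \<union> W).
        (\<forall>u \<in> U. \<forall>u' \<in> U. u \<rightarrow>\<^bsub>G\<^esub> v \<longleftrightarrow> u' \<rightarrow>\<^bsub>G\<^esub> v) \<and>
        (\<forall>w \<in> W. \<forall>w' \<in> W. w \<rightarrow>\<^bsub>G\<^esub> v \<longleftrightarrow> w' \<rightarrow>\<^bsub>G\<^esub> v)) \<and>
     (\<forall>u \<in> U. \<forall>w \<in> W. card (neighbours G u - W) = card (neighbours G w - U))"

definition map_edges :: "('a \<Rightarrow> 'b) \<Rightarrow> ('a \<times> 'a) set \<Rightarrow> ('b \<times> 'b) set" where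
  "map_edges f F = map_prod f f ` F"

definition add_edges :: "'v pair_pre_digraph \<Rightarrow> ('v \<times> 'v) set \<Rightarrow> 'v pair_pre_digraph" where
  "add_edges G F = G\<lparr>parcs := parcs G \<union> F\<rparr>"

text \<open>
  Matrices are indexed by natural numbers, so a matrix of a graph is formed with respect to a
  list that enumerates the vertices without repetition.
\<close>

definition vertex_enumeration :: "('v, 'e) pre_digraph \<Rightarrow> 'v list \<Rightarrow> bool" where
  "vertex_enumeration G vs \<longleftrightarrow> distinct vs \<and> set vs = verts G"

definition adjacency_matrix :: "('v, 'e) pre_digraph \<Rightarrow> 'v list \<Rightarrow> real mat" where
  "adjacency_matrix G vs =
     mat (length vs) (length vs) (\<lambda>(i, j). if vs ! i \<rightarrow>\<^bsub>G\<^esub> vs ! j then 1 else 0)"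

definition degree_matrix :: "('v, 'e) pre_digraph \<Rightarrow> 'v list \<Rightarrow> real mat" where
  "degree_matrix G vs = mat_diag (length vs) (\<lambda>i. real (out_degree G (vs ! i)))"

definition laplacian :: "('v, 'e) pre_digraph \<Rightarrow> 'v list \<Rightarrow> real mat" where
  "laplacian G vs = degree_matrix G vs - adjacency_matrix G vs"

text \<open>This is $D^{-1/2}$ when there is no isolated vertex (recall that \<^prop>\<open>1 / (0::real) = 0\<close>).\<close>

definition inv_sqrt_degree_matrix :: "('v, 'e) pre_digraph \<Rightarrow> 'v list \<Rightarrow> real mat" where
  "inv_sqrt_degree_matrix G vs =
     mat_diag (length vs) (\<lambda>i. 1 / sqrt (real (out_degree G (vs ! i))))"

definition normalized_laplacian :: "('v, 'e) pre_digraph \<Rightarrow> 'v list \<Rightarrow> real mat" where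
  "normalized_laplacian G vs =
     inv_sqrt_degree_matrix G vs * laplacian G vs * inv_sqrt_degree_matrix G vs"

text \<open>
  Passing to the complex numbers makes the characteristic polynomial split, so that every
  eigenvalue is counted with its algebraic multiplicity.
\<close>

definition eigenvalue_mset :: "real mat \<Rightarrow> complex multiset" where
  "eigenvalue_mset A = proots (char_poly (map_mat complex_of_real A))"

text \<open>
  The eigenvalues do not depend on the enumeration, and a finite graph has an enumeration; hence
  for finite graphs it does not matter whether the enumerations are quantified universally or
  existentially.
\<close>

definition cospectral ::
  "(('v, 'e) pre_digraph \<Rightarrow> 'v list \<Rightarrow> real mat) \<Rightarrow>
   ('v, 'e) pre_digraph \<Rightarrow> ('v, 'e) pre_digraph \<Rightarrow> bool" where
  "cospectral M G H \<longleftrightarrow>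
     (\<forall>vs ws. vertex_enumeration G vs \<longrightarrow> vertex_enumeration H ws \<longrightarrow>
        eigenvalue_mset (M G vs) = eigenvalue_mset (M H ws))"

end

theory Submission
  imports Defs
begin

text \<open>
  Put $W = V_1 \cup V_2$. Since $\pi$ swaps $V_1$ and $V_2$ and preserves the edges between them,
  it is an isomorphism between $G_1[W]$ and $G_2[W]$; but it is not one between $G_1$ and $G_2$,
  because the vertices outside $W$ need not treat $V_1$ and $V_2$ alike. So the permutation matrix
  $P$ of $\pi$ on $W$ has to be corrected in such a way that it fixes the indicator vectors of $V_1$
  and $V_2$: by the cousin condition, the columns of the adjacency block between $W$ and the rest
  are combinations of these two.

  The correction is $Q = \frac{1}{m} J - P$ with $J$ the all-ones matrix on $W$. It is a symmetric
  involution; it maps the indicator of $V_1$ to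
  $\mathbf{1}_W - \mathbf{1}_{V_2} = \mathbf{1}_{V_1}$, and likewise for $V_2$. Regularity of
  $G_1[W]$ with adjacency matrix $M$ gives $MJ = JM$, hence $QM = (PMP)Q$, where $PMP$ is the
  adjacency matrix of $G_2[W]$. Extended by the identity outside $W$, $Q$ therefore intertwines
  the adjacency matrices of $G_1$ and $G_2$ (lemma \<open>reflection_intertwines\<close>).

  All vertices of $W$ have the same degree in $G_1$: inside $W$ by regularity, and outside because
  cousins have equally many outer neighbours. The degrees in $G_2$ are the same as in $G_1$. So
  $Q$ commutes with the degree matrix, and it intertwines the normalized Laplacians as well
  (lemma \<open>reflection_intertwines_normalized\<close>), which are thus similar matrices.
\<close>

section \<open>Matrices indexed by vertices\<close>

text \<open>
  The rows and the columns may be enumerated differently. This is what lets one similarity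
  compare matrices formed with respect to two enumerations of the same vertex set.
\<close>

definition kernel_mat :: "'v list \<Rightarrow> 'v list \<Rightarrow> ('v \<Rightarrow> 'v \<Rightarrow> real) \<Rightarrow> real mat" where
  "kernel_mat us vs f = mat (length us) (length vs) (\<lambda>(i, j). f (us ! i) (vs ! j))"

lemma kernel_mat_carrier [simp]: "kernel_mat us vs f \<in> carrier_mat (length us) (length vs)"
  by (simp add: kernel_mat_def)

lemma kernel_mat_mult:
  assumes "distinct vs"
  shows "kernel_mat us vs f * kernel_mat vs ws g =
    kernel_mat us ws (\<lambda>x z. \<Sum>y\<in>set vs. f x y * g y z)"
proof (rule eq_matI)
  fix i j
  assume "i < dim_row (kernel_mat us ws (\<lambda>x z. \<Sum>y\<in>set vs. f x y * g y z))"
    and "j < dim_col (kernel_mat us ws (\<lambda>x z. \<Sum>y\<in>set vs. f x y * g y z))"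
  then have ij: "i < length us" "j < length ws"
    by (simp_all add: kernel_mat_def)
  have "bij_betw ((!) vs) {0..<length vs} (set vs)"
    using bij_betw_nth[OF assms] by (simp add: atLeast0LessThan)
  from sum.reindex_bij_betw[OF this, of "\<lambda>y. f (us ! i) y * g y (ws ! j)"] ij
  show "(kernel_mat us vs f * kernel_mat vs ws g) $$ (i, j) =
      kernel_mat us ws (\<lambda>x z. \<Sum>y\<in>set vs. f x y * g y z) $$ (i, j)"
    by (simp add: kernel_mat_def scalar_prod_def)
qed (simp_all add: kernel_mat_def)

lemma kernel_mat_cong:
  assumes "\<And>x y. x \<in> set us \<Longrightarrow> y \<in> set vs \<Longrightarrow> f x y = g x y"
  shows "kernel_mat us vs f = kernel_mat us vs g"
  by (rule eq_matI) (use assms in \<open>auto simp: kernel_mat_def\<close>)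

lemma kernel_mat_identity:
  assumes "distinct vs"
  shows "kernel_mat vs vs (\<lambda>x y. if x = y then 1 else 0) = 1\<^sub>m (length vs)"
  by (rule eq_matI) (use assms in \<open>auto simp: kernel_mat_def nth_eq_iff_index_eq\<close>)

text \<open>
  Listing the rows of \<open>t\<close> by \<open>vs\<close> and its columns by \<open>ws\<close>, or the other way round, gives two
  matrices that are inverse to each other because \<open>t\<close> is an involution.
\<close>

lemma similar_kernel_mat:
  assumes vs: "distinct vs" "set vs = V" and ws: "distinct ws" "set ws = V"
    and involution: "\<And>x z. x \<in> V \<Longrightarrow> z \<in> V \<Longrightarrow> (\<Sum>y\<in>V. t x y * t y z) = (if x = z then 1 else 0)"
    and intertwines: "\<And>x z. x \<in> V \<Longrightarrow> z \<in> V \<Longrightarrow> (\<Sum>y\<in>V. t x y * f y z) = (\<Sum>y\<in>V. g x y * t y z)"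
  shows "similar_mat (kernel_mat vs vs f) (kernel_mat ws ws g)"
proof (rule similar_matI)
  have len: "length ws = length vs"
    using vs ws by (metis distinct_card)
  let ?P = "kernel_mat vs ws t" and ?Q = "kernel_mat ws vs t"
  show "{kernel_mat vs vs f, kernel_mat ws ws g, ?P, ?Q} \<subseteq> carrier_mat (length vs) (length vs)"
    using kernel_mat_carrier[of vs vs] kernel_mat_carrier[of ws ws] kernel_mat_carrier[of vs ws]
      kernel_mat_carrier[of ws vs] unfolding len by simp
  have "?P * ?Q = kernel_mat vs vs (\<lambda>x y. if x = y then 1 else 0)"
    unfolding kernel_mat_mult[OF ws(1)] by (rule kernel_mat_cong) (simp add: vs ws involution)
  then show PQ: "?P * ?Q = 1\<^sub>m (length vs)"
    using kernel_mat_identity[OF vs(1)] by simp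
  have "?Q * ?P = kernel_mat ws ws (\<lambda>x y. if x = y then 1 else 0)"
    unfolding kernel_mat_mult[OF vs(1)] by (rule kernel_mat_cong) (simp add: vs ws involution)
  then show "?Q * ?P = 1\<^sub>m (length vs)"
    using kernel_mat_identity[OF ws(1)] len by simp
  have "?Q * kernel_mat vs vs f = kernel_mat ws ws g * ?Q"
    unfolding kernel_mat_mult[OF vs(1)] kernel_mat_mult[OF ws(1)]
    by (rule kernel_mat_cong) (simp add: vs ws intertwines)
  then have "?P * kernel_mat ws ws g * ?Q = ?P * (?Q * kernel_mat vs vs f)"
    using assoc_mult_mat[OF kernel_mat_carrier kernel_mat_carrier kernel_mat_carrier, of vs ws t ws g vs t]
    by simp
  also have "\<dots> = (?P * ?Q) * kernel_mat vs vs f"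
    using assoc_mult_mat[OF kernel_mat_carrier kernel_mat_carrier kernel_mat_carrier, of vs ws t vs t vs f]
    by simp
  also have "\<dots> = kernel_mat vs vs f"
    unfolding PQ by (rule left_mult_one_mat[OF kernel_mat_carrier])
  finally show "kernel_mat vs vs f = ?P * kernel_mat ws ws g * ?Q" by simp
qed

lemma similar_mat_eigenvalue_mset:
  assumes "similar_mat A B"
  shows "eigenvalue_mset A = eigenvalue_mset B"
proof -
  obtain n where "A \<in> carrier_mat n n" "B \<in> carrier_mat n n"
    using similar_matD[OF assms] by blast
  then show ?thesis
    using char_poly_similar[OF assms] unfolding eigenvalue_mset_def
    by (metis of_real_hom.char_poly_hom)
qed

section \<open>The normalized Laplacian of a weighted graph\<close>

definition weighted_degree :: "'v set \<Rightarrow> ('v \<Rightarrow> 'v \<Rightarrow> real) \<Rightarrow> 'v \<Rightarrow> real" where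
  "weighted_degree V a x = (\<Sum>y\<in>V. a x y)"

definition normalized_kernel :: "'v set \<Rightarrow> ('v \<Rightarrow> 'v \<Rightarrow> real) \<Rightarrow> 'v \<Rightarrow> 'v \<Rightarrow> real" where
  "normalized_kernel V a x y =
     1 / sqrt (weighted_degree V a x) *
     ((if x = y then weighted_degree V a x else 0) - a x y) *
     (1 / sqrt (weighted_degree V a y))"

definition adjacency :: "'v pair_pre_digraph \<Rightarrow> 'v \<Rightarrow> 'v \<Rightarrow> real" where
  "adjacency H x y = of_bool ((x, y) \<in> parcs H)"

lemma sum_adjacency:
  assumes "finite S"
  shows "(\<Sum>y\<in>S. adjacency H x y) = real (card {y \<in> S. (x, y) \<in> parcs H})"
  using assms by (simp add: adjacency_def sum_of_bool_eq Int_def)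

lemma out_degree_eq_card:
  "out_degree (with_proj H) x = card {y. (x, y) \<in> parcs H}"
proof -
  have "out_arcs (with_proj H) x = Pair x ` {y. (x, y) \<in> parcs H}"
    by (auto simp: out_arcs_def)
  then show ?thesis
    by (simp add: out_degree_def card_image inj_on_def)
qed

lemma out_degree_induced_eq_card:
  assumes "x \<in> S"
  shows "out_degree (with_proj H \<restriction> S) x = card {y \<in> S. (x, y) \<in> parcs H}"
proof -
  have "out_arcs (with_proj H \<restriction> S) x = Pair x ` {y \<in> S. (x, y) \<in> parcs H}"
    using assms by (auto simp: out_arcs_def)
  then show ?thesis
    by (simp add: out_degree_def card_image inj_on_def)
qed

lemma out_degree_eq_weighted_degree:
  assumes "finite (pverts H)" and "parcs H \<subseteq> pverts H \<times> pverts H"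
  shows "real (out_degree (with_proj H) x) = weighted_degree (pverts H) (adjacency H) x"
proof -
  have "{y. (x, y) \<in> parcs H} = {y \<in> pverts H. (x, y) \<in> parcs H}"
    using assms(2) by auto
  then show ?thesis
    by (simp add: out_degree_eq_card weighted_degree_def sum_adjacency[OF assms(1)])
qed

lemma normalized_laplacian_eq_kernel_mat:
  assumes "finite (pverts H)" and "parcs H \<subseteq> pverts H \<times> pverts H" and "distinct vs"
  shows "normalized_laplacian (with_proj H) vs =
    kernel_mat vs vs (normalized_kernel (pverts H) (adjacency H))"
proof -
  define s where "s i = 1 / sqrt (weighted_degree (pverts H) (adjacency H) (vs ! i))" for i
  have lap: "laplacian (with_proj H) vs \<in> carrier_mat (length vs) (length vs)"
    by (auto simp: laplacian_def degree_matrix_def adjacency_matrix_def)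
  have "normalized_laplacian (with_proj H) vs =
      mat (length vs) (length vs) (\<lambda>(i, j). s i * laplacian (with_proj H) vs $$ (i, j) * s j)"
    unfolding normalized_laplacian_def inv_sqrt_degree_matrix_def
      out_degree_eq_weighted_degree[OF assms(1,2)] s_def[symmetric]
      mat_diag_mult_left[OF lap]
    by (subst mat_diag_mult_right[of _ "length vs"]) auto
  also have "\<dots> = kernel_mat vs vs (normalized_kernel (pverts H) (adjacency H))"
    by (rule eq_matI)
      (use assms(3) in \<open>auto simp: kernel_mat_def normalized_kernel_def laplacian_def
         degree_matrix_def adjacency_matrix_def mat_diag_def s_def adjacency_def
         nth_eq_iff_index_eq out_degree_eq_weighted_degree[OF assms(1,2)]\<close>)
  finally show ?thesis .
qed

section \<open>Exchanging two cousin sets\<close>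

text \<open>
  The functions \<open>a\<close> and \<open>b\<close> are the weights of two graphs on \<open>V\<close> that differ by applying
  \<open>\<pi>\<close> inside \<open>V1 \<union> V2\<close>. With weights, the cousin condition and regularity become identities
  between sums, which is the form in which matrix products use them.
\<close>

locale cousin_exchange =
  fixes V V1 V2 :: "'v set" and \<pi> :: "'v \<Rightarrow> 'v" and a b :: "'v \<Rightarrow> 'v \<Rightarrow> real" and k d :: real
  assumes finite_V: "finite V" and V1_subset: "V1 \<subseteq> V" and V2_subset: "V2 \<subseteq> V"
    and disjoint: "V1 \<inter> V2 = {}"
    and swap_V1: "\<pi> ` V1 = V2" and swap_V2: "\<pi> ` V2 = V1"
    and involutive: "\<And>x. x \<in> V1 \<union> V2 \<Longrightarrow> \<pi> (\<pi> x) = x"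
    and symmetric: "\<And>x y. a x y = a y x"
    and exchanged: "\<And>x y. x \<in> V1 \<union> V2 \<Longrightarrow> y \<in> V1 \<union> V2 \<Longrightarrow> b x y = a (\<pi> x) (\<pi> y)"
    and unchanged: "\<And>x y. \<not> (x \<in> V1 \<union> V2 \<and> y \<in> V1 \<union> V2) \<Longrightarrow> b x y = a x y"
    and cousins1: "\<And>v x y. v \<in> V - (V1 \<union> V2) \<Longrightarrow> x \<in> V1 \<Longrightarrow> y \<in> V1 \<Longrightarrow> a x v = a y v"
    and cousins2: "\<And>v x y. v \<in> V - (V1 \<union> V2) \<Longrightarrow> x \<in> V2 \<Longrightarrow> y \<in> V2 \<Longrightarrow> a x v = a y v"
    and inner_degree: "\<And>x. x \<in> V1 \<union> V2 \<Longrightarrow> (\<Sum>y\<in>V1 \<union> V2. a x y) = k"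
    and outer_degree: "\<And>x. x \<in> V1 \<union> V2 \<Longrightarrow> (\<Sum>y\<in>V - (V1 \<union> V2). a x y) = d"
begin

abbreviation "W \<equiv> V1 \<union> V2"

text \<open>The matrix $Q = \frac{1}{m} J - P$ on \<open>W\<close>, extended by the identity.\<close>

definition reflection :: "'v \<Rightarrow> 'v \<Rightarrow> real" where
  "reflection x y =
     (if x \<in> W \<and> y \<in> W then 1 / card V1 - (if y = \<pi> x then 1 else 0)
      else if x = y then 1 else 0)"

lemma W_subset: "W \<subseteq> V"
  using V1_subset V2_subset by blast

lemma finite_W: "finite W"
  using W_subset finite_V finite_subset by blast

lemma swap_in_W: "x \<in> W \<Longrightarrow> \<pi> x \<in> W"
  using swap_V1 swap_V2 by blast

lemma card_V2: "card V2 = card V1"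
proof -
  have "inj_on \<pi> V1"
    by (rule inj_on_inverseI[of _ \<pi>]) (simp add: involutive)
  then show ?thesis
    using swap_V1 card_image by blast
qed

lemma card_W: "card W = 2 * card V1"
  using card_Un_disjoint[of V1 V2] finite_W disjoint card_V2 by simp

lemma card_V1_nonzero: "x \<in> W \<Longrightarrow> card V1 \<noteq> 0"
  using card_W finite_W by (metis card_0_eq empty_iff mult_0_right)

lemma reflection_sym: "reflection x y = reflection y x"
proof -
  have "x \<in> W \<Longrightarrow> y \<in> W \<Longrightarrow> y = \<pi> x \<longleftrightarrow> x = \<pi> y"
    using involutive by metis
  then show ?thesis
    by (auto simp: reflection_def)
qed

lemma sum_reflection_inside:
  assumes "x \<in> W"
  shows "(\<Sum>y\<in>V. reflection x y * f y) = (\<Sum>y\<in>W. f y) / card V1 - f (\<pi> x)"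
proof -
  have "(\<Sum>y\<in>V. reflection x y * f y) = (\<Sum>y\<in>W. reflection x y * f y)"
    by (rule sum.mono_neutral_right[OF finite_V W_subset])
      (use assms in \<open>auto simp: reflection_def\<close>)
  also have "\<dots> = (\<Sum>y\<in>W. f y / card V1 - (if y = \<pi> x then f y else 0))"
    by (rule sum.cong) (use assms in \<open>auto simp: reflection_def algebra_simps\<close>)
  also have "\<dots> = (\<Sum>y\<in>W. f y) / card V1 - f (\<pi> x)"
    using swap_in_W[OF assms] finite_W
    by (simp add: sum_subtractf sum_divide_distrib)
  finally show ?thesis .
qed

lemma sum_reflection_outside:
  assumes "x \<in> V - W"
  shows "(\<Sum>y\<in>V. reflection x y * f y) = f x"
proof -
  have "(\<Sum>y\<in>V. reflection x y * f y) = (\<Sum>y\<in>V. if y = x then f y else 0)"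
    by (rule sum.cong) (use assms in \<open>auto simp: reflection_def\<close>)
  also have "\<dots> = f x"
    using assms finite_V by simp
  finally show ?thesis .
qed

text \<open>
  On \<open>W\<close> this is $Q^2 = \frac{1}{m^2} J^2 - \frac{2}{m} J + P^2 = I$, since $J^2 = 2mJ$.
\<close>

lemma reflection_involution:
  assumes "x \<in> V" "z \<in> V"
  shows "(\<Sum>y\<in>V. reflection x y * reflection y z) = (if x = z then 1 else 0)"
proof (cases "x \<in> W")
  case False
  then show ?thesis
    using assms sum_reflection_outside[of x "\<lambda>y. reflection y z"] by (auto simp: reflection_def)
next
  case x: True
  note m = card_V1_nonzero[OF x]
  show ?thesis
  proof (cases "z \<in> W")
    case True
    have "(\<Sum>y\<in>W. reflection y z) = (\<Sum>y\<in>W. reflection z y)"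
      by (rule sum.cong[OF refl reflection_sym])
    also have "\<dots> = (\<Sum>y\<in>W. 1 / card V1 - (if y = \<pi> z then 1 else 0))"
      by (rule sum.cong) (use True in \<open>auto simp: reflection_def\<close>)
    also have "\<dots> = 1"
      using swap_in_W[OF True] finite_W m by (simp add: sum_subtractf card_W)
    finally show ?thesis
      using x True swap_in_W[OF x] sum_reflection_inside[OF x, of "\<lambda>y. reflection y z"]
      by (auto simp: reflection_def involutive)
  next
    case False
    have "(\<Sum>y\<in>W. reflection y z) = 0"
      by (rule sum.neutral) (use False in \<open>auto simp: reflection_def\<close>)
    then show ?thesis
      using x False swap_in_W[OF x] sum_reflection_inside[OF x, of "\<lambda>y. reflection y z"]
      by (auto simp: reflection_def)
  qed
qed

text \<open>
  A column of the block between \<open>W\<close> and its complement is constant on \<open>V1\<close> and on \<open>V2\<close>.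
  Applying $\frac{1}{m} J$ yields the sum of its two values, and $P$ takes away the value on the
  other half. Hence the reflection fixes the column.
\<close>

lemma cousin_column_sum:
  assumes "x \<in> W" and "v \<in> V - W"
  shows "(\<Sum>y\<in>W. a y v) / card V1 - a (\<pi> x) v = a x v"
proof -
  have split: "(\<Sum>y\<in>W. a y v) = (\<Sum>y\<in>V1. a y v) + (\<Sum>y\<in>V2. a y v)"
    using finite_W disjoint by (intro sum.union_disjoint) auto
  have sums: "(\<Sum>y\<in>V1. a y v) = card V1 * a p v" "(\<Sum>y\<in>V2. a y v) = card V1 * a q v"
    if "p \<in> V1" "q \<in> V2" for p q
  proof -
    have "(\<Sum>y\<in>V1. a y v) = (\<Sum>y\<in>V1. a p v)"
      by (intro sum.cong refl cousins1[OF assms(2)] that)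
    then show "(\<Sum>y\<in>V1. a y v) = card V1 * a p v" by simp
    have "(\<Sum>y\<in>V2. a y v) = (\<Sum>y\<in>V2. a q v)"
      by (intro sum.cong refl cousins2[OF assms(2)] that)
    then show "(\<Sum>y\<in>V2. a y v) = card V1 * a q v" by (simp add: card_V2)
  qed
  note m = card_V1_nonzero[OF assms(1)]
  show ?thesis
  proof (cases "x \<in> V1")
    case True
    then have "\<pi> x \<in> V2" using swap_V1 by blast
    then show ?thesis
      unfolding split sums[OF True \<open>\<pi> x \<in> V2\<close>] using m by (simp add: field_simps)
  next
    case False
    then have x: "x \<in> V2" using assms(1) by blast
    then have "\<pi> x \<in> V1" using swap_V2 by blast
    then show ?thesis
      unfolding split sums[OF \<open>\<pi> x \<in> V1\<close> x] using m by (simp add: field_simps)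
  qed
qed

lemma inner_degree_exchanged:
  assumes "x \<in> W"
  shows "(\<Sum>y\<in>W. b x y) = k"
proof -
  have "(\<Sum>y\<in>W. b x y) = (\<Sum>y\<in>W. a (\<pi> x) (\<pi> y))"
    using assms exchanged by simp
  also have "\<dots> = (\<Sum>y\<in>W. a (\<pi> x) y)"
    by (rule sum.reindex_bij_witness[of _ \<pi> \<pi>]) (use swap_in_W involutive in auto)
  also have "\<dots> = k"
    by (rule inner_degree[OF swap_in_W[OF assms]])
  finally show ?thesis .
qed

text \<open>
  Inside \<open>W\<close> both sides are $\frac{k}{m} J - PM$, by regularity; the mixed blocks agree by the
  cousin condition.
\<close>

lemma reflection_intertwines:
  assumes x: "x \<in> V" and z: "z \<in> V"
  shows "(\<Sum>y\<in>V. reflection x y * a y z) = (\<Sum>y\<in>V. b x y * reflection y z)"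
proof -
  have right: "(\<Sum>y\<in>V. b x y * reflection y z) = (\<Sum>y\<in>V. reflection z y * b x y)"
    by (simp add: reflection_sym[of _ z] mult.commute)
  show ?thesis
  proof (cases "x \<in> W"; cases "z \<in> W")
    assume xW: "x \<in> W" and zW: "z \<in> W"
    have "(\<Sum>y\<in>W. b x y) = k"
      by (rule inner_degree_exchanged[OF xW])
    moreover have "(\<Sum>y\<in>W. a y z) = k"
      using inner_degree[OF zW] by (simp add: symmetric[of _ z])
    moreover have "b x (\<pi> z) = a (\<pi> x) z"
      using exchanged[OF xW swap_in_W[OF zW]] involutive[OF zW] by simp
    ultimately show ?thesis
      unfolding right sum_reflection_inside[OF xW] sum_reflection_inside[OF zW] by simp
  next
    assume xW: "x \<in> W" and zW: "z \<notin> W"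
    then show ?thesis
      unfolding right sum_reflection_inside[OF xW]
      using z sum_reflection_outside[of z "b x"] cousin_column_sum[OF xW, of z] unchanged[of x z]
      by simp
  next
    assume xW: "x \<notin> W" and zW: "z \<in> W"
    have "b x y = a y x" for y
      using unchanged[of x y] symmetric xW by simp
    then show ?thesis
      unfolding right sum_reflection_inside[OF zW]
      using x xW sum_reflection_outside[of x "\<lambda>y. a y z"] cousin_column_sum[OF zW, of x]
        symmetric[of x z]
      by simp
  next
    assume "x \<notin> W" "z \<notin> W"
    then show ?thesis
      unfolding right
      using x z sum_reflection_outside[of x "\<lambda>y. a y z"] sum_reflection_outside[of z "b x"]
        unchanged[of x z]
      by simp
  qed
qed

lemma weighted_degree_split:
  "weighted_degree V c x = (\<Sum>y\<in>W. c x y) + (\<Sum>y\<in>V - W. c x y)"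
  unfolding weighted_degree_def using sum.subset_diff[OF W_subset finite_V] by (simp add: add.commute)

lemma weighted_degree_W: "x \<in> W \<Longrightarrow> weighted_degree V a x = k + d"
  by (simp add: weighted_degree_split inner_degree outer_degree)

lemma weighted_degree_exchanged: "weighted_degree V b x = weighted_degree V a x"
proof (cases "x \<in> W")
  case False
  then show ?thesis by (simp add: weighted_degree_def unchanged)
next
  case x: True
  then show ?thesis
    using weighted_degree_W[OF x] inner_degree_exchanged[OF x] outer_degree[OF x] unchanged
    by (simp add: weighted_degree_split)
qed

text \<open>
  Off the diagonal the reflection is supported on \<open>W\<close>, where the degree is constant; so it
  commutes with every diagonal matrix that depends on the degree only. The instances in use are
  $D$ and $D^{-1/2}$.
\<close>

lemma reflection_commutes_degree:
  "reflection x y * h (weighted_degree V a y) = h (weighted_degree V a x) * reflection x y"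
  by (auto simp: reflection_def weighted_degree_W)

text \<open>
  With $A, B$ the two adjacency matrices,
  $Q D^{-1/2} (D - A) D^{-1/2} = D^{-1/2} (D Q - Q A) D^{-1/2} = D^{-1/2} (D Q - B Q) D^{-1/2}$, and
  moving $Q$ past the last factor gives the claim.
\<close>

lemma reflection_intertwines_normalized:
  assumes "x \<in> V" "z \<in> V"
  shows "(\<Sum>y\<in>V. reflection x y * normalized_kernel V a y z) =
    (\<Sum>y\<in>V. normalized_kernel V b x y * reflection y z)"
proof -
  define \<delta> where "\<delta> = weighted_degree V a"
  define s where "s x = 1 / sqrt (\<delta> x)" for x
  have nka: "normalized_kernel V a y z = s y * ((if y = z then \<delta> y else 0) - a y z) * s z" for y z
    by (simp add: normalized_kernel_def s_def \<delta>_def)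
  have nkb: "normalized_kernel V b y z = s y * ((if y = z then \<delta> y else 0) - b y z) * s z" for y z
    by (simp add: normalized_kernel_def s_def \<delta>_def weighted_degree_exchanged)
  have comm_s: "reflection x y * s y = s x * reflection x y" for x y
    using reflection_commutes_degree[of x y "\<lambda>t. 1 / sqrt t"] by (simp add: s_def \<delta>_def)
  have comm_deg: "reflection x z * \<delta> z = \<delta> x * reflection x z"
    using reflection_commutes_degree[of x z "\<lambda>t. t"] by (simp add: \<delta>_def)
  have "reflection x y * normalized_kernel V a y z =
      s x * s z * ((if y = z then reflection x z * \<delta> z else 0) - reflection x y * a y z)" for y
  proof -
    have "reflection x y * normalized_kernel V a y z =
        (reflection x y * s y) * ((if y = z then \<delta> y else 0) - a y z) * s z"
      by (simp add: nka)
    also have "\<dots> = (s x * reflection x y) * ((if y = z then \<delta> y else 0) - a y z) * s z"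
      by (simp only: comm_s)
    finally show ?thesis by (simp add: algebra_simps)
  qed
  then have "(\<Sum>y\<in>V. reflection x y * normalized_kernel V a y z) =
      s x * s z * (reflection x z * \<delta> z - (\<Sum>y\<in>V. reflection x y * a y z))"
    using assms finite_V by (simp add: sum_distrib_left[symmetric] sum_subtractf)
  also have "\<dots> = s x * s z * (\<delta> x * reflection x z - (\<Sum>y\<in>V. b x y * reflection y z))"
    by (simp only: comm_deg reflection_intertwines[OF assms])
  also have "\<dots> = (\<Sum>y\<in>V. s x * s z *
      ((if y = x then \<delta> x * reflection x z else 0) - b x y * reflection y z))"
    using assms finite_V by (simp add: sum_distrib_left[symmetric] sum_subtractf)
  also have "\<dots> = (\<Sum>y\<in>V. normalized_kernel V b x y * reflection y z)"
  proof (rule sum.cong[OF refl])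
    fix y
    have "normalized_kernel V b x y * reflection y z =
        s x * ((if x = y then \<delta> x else 0) - b x y) * (s y * reflection y z)"
      by (simp add: nkb)
    also have "\<dots> = s x * ((if x = y then \<delta> x else 0) - b x y) * (reflection y z * s z)"
      by (simp only: comm_s)
    finally show "s x * s z * ((if y = x then \<delta> x * reflection x z else 0) - b x y * reflection y z) =
        normalized_kernel V b x y * reflection y z"
      by (auto simp: algebra_simps)
  qed
  finally show ?thesis .
qed

end

section \<open>Gluing and cospectrality\<close>

lemma map_edges_subset:
  assumes "F \<subseteq> A \<times> A" and "f ` A \<subseteq> B"
  shows "map_edges f F \<subseteq> B \<times> B"
  using assms by (fastforce simp: map_edges_def)

lemma sym_map_edges:
  assumes "sym F"
  shows "sym (map_edges f F)"
  using assms by (force simp: map_edges_def sym_def)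

lemma map_edges_involution_iff:
  assumes "F \<subseteq> S \<times> S" and "\<And>v. v \<in> S \<Longrightarrow> f (f v) = v" and "x \<in> S" "y \<in> S"
  shows "(x, y) \<in> map_edges f F \<longleftrightarrow> (f x, f y) \<in> F"
proof
  assume "(x, y) \<in> map_edges f F"
  then show "(f x, f y) \<in> F"
    using assms by (auto simp: map_edges_def)
next
  assume "(f x, f y) \<in> F"
  then show "(x, y) \<in> map_edges f F"
    using assms(2-4) unfolding map_edges_def by (intro image_eqI[of _ _ "(f x, f y)"]) auto
qed

lemma pair_graph_parcs:
  assumes "pair_graph H"
  shows "parcs H \<subseteq> pverts H \<times> pverts H" and "sym (parcs H)"
proof -
  interpret pair_graph H by fact
  show "parcs H \<subseteq> pverts H \<times> pverts H"
    using wellformed' by auto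
  show "sym (parcs H)"
    using pair_sym_arcs by (simp add: symmetric_def)
qed

theorem corollary2p13:
  fixes G G1 G2 :: "'v pair_pre_digraph"
    and H1 :: "'a pair_pre_digraph" and H2 :: "'b pair_pre_digraph"
    and V1 V2 :: "'v set" and m :: nat
    and \<pi> :: "'v \<Rightarrow> 'v" and \<phi>1 :: "'a \<Rightarrow> 'v" and \<phi>2 :: "'b \<Rightarrow> 'v"
  assumes "pair_graph G"
    and "V1 \<subseteq> pverts G" and "V2 \<subseteq> pverts G" and "V1 \<inter> V2 = {}"
    and "card V1 = m" and "card V2 = m"
    and "arcs (with_proj G \<restriction> V1) = {}" and "arcs (with_proj G \<restriction> V2) = {}"
    and "graph_automorphism (with_proj G \<restriction> (V1 \<union> V2)) \<pi>"
    and "\<pi> ` V1 = V2" and "\<pi> ` V2 = V1" and "\<forall>v \<in> V1 \<union> V2. \<pi> (\<pi> v) = v"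
    and "pair_graph H1" and "card (pverts H1) = m"
    and "pair_graph H2" and "card (pverts H2) = m"
    and "bij_betw \<phi>1 (pverts H1) V1" and "bij_betw \<phi>2 (pverts H2) V2"
    and "G1 = add_edges (add_edges G (map_edges \<phi>1 (parcs H1))) (map_edges \<phi>2 (parcs H2))"
    and "G2 = add_edges (add_edges G (map_edges \<pi> (map_edges \<phi>1 (parcs H1))))
                (map_edges \<pi> (map_edges \<phi>2 (parcs H2)))"
    and "no_isolated_vertex (with_proj G1)" and "no_isolated_vertex (with_proj G2)"
    and "co_degree_cousins (with_proj G) V1 V2"
    and "regular_graph (with_proj G1 \<restriction> (V1 \<union> V2))"
  shows "cospectral normalized_laplacian (with_proj G1) (with_proj G2)"
proof -
  note G = assms(1) and V1 = assms(2) and V2 = assms(3) and disj = assms(4)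
    and empty1 = assms(7) and empty2 = assms(8) and auto_pi = assms(9)
    and swap1 = assms(10) and swap2 = assms(11) and invol = assms(12)
    and H1 = assms(13) and H2 = assms(15) and bij1 = assms(17) and bij2 = assms(18)
    and G1_def = assms(19) and G2_def = assms(20)
    and cousins = assms(23) and regular = assms(24)
  interpret G: pair_graph G by (fact G)
  define W where "W = V1 \<union> V2"
  define F where "F = map_edges \<phi>1 (parcs H1) \<union> map_edges \<phi>2 (parcs H2)"
  have W_sub: "W \<subseteq> pverts G" using V1 V2 by (simp add: W_def)
  have finW: "finite W" using W_sub G.pair_finite_verts finite_subset by blast
  have piW: "\<pi> ` W = W" using swap1 swap2 by (auto simp: W_def)
  have invW: "\<pi> (\<pi> v) = v" if "v \<in> W" for v using that invol by (simp add: W_def)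
  have F_sub: "F \<subseteq> W \<times> W"
  proof -
    have "map_edges \<phi>1 (parcs H1) \<subseteq> V1 \<times> V1"
      by (rule map_edges_subset[OF pair_graph_parcs(1)[OF H1]])
        (use bij1 in \<open>simp add: bij_betw_def\<close>)
    moreover have "map_edges \<phi>2 (parcs H2) \<subseteq> V2 \<times> V2"
      by (rule map_edges_subset[OF pair_graph_parcs(1)[OF H2]])
        (use bij2 in \<open>simp add: bij_betw_def\<close>)
    ultimately show ?thesis by (auto simp: F_def W_def)
  qed
  have F_sym: "sym F"
    unfolding F_def by (intro sym_Un sym_map_edges pair_graph_parcs(2) H1 H2)
  have piF_sub: "map_edges \<pi> F \<subseteq> W \<times> W"
    by (rule map_edges_subset[OF F_sub]) (simp add: piW)
  have verts12: "pverts G1 = pverts G" "pverts G2 = pverts G"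
    by (simp_all add: G1_def G2_def add_edges_def)
  have arcs1: "parcs G1 = parcs G \<union> F"
    by (simp add: G1_def add_edges_def F_def Un_assoc)
  have arcs2: "parcs G2 = parcs G \<union> map_edges \<pi> F"
    by (auto simp: G2_def add_edges_def F_def map_edges_def)
  have wf1: "parcs G1 \<subseteq> pverts G1 \<times> pverts G1"
    using pair_graph_parcs(1)[OF G] F_sub W_sub unfolding arcs1 verts12 by blast
  have wf2: "parcs G2 \<subseteq> pverts G2 \<times> pverts G2"
    using pair_graph_parcs(1)[OF G] piF_sub W_sub unfolding arcs2 verts12 by blast
  have sym1: "sym (parcs G1)"
    unfolding arcs1 by (intro sym_Un F_sym pair_graph_parcs(2) G)

  have pi_G: "(x, y) \<in> parcs G \<longleftrightarrow> (\<pi> x, \<pi> y) \<in> parcs G" if "x \<in> W" "y \<in> W" for x y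
  proof -
    have "arcs_ends (with_proj G \<restriction> W) = {e \<in> parcs G. fst e \<in> W \<and> snd e \<in> W}"
      by (auto simp: arcs_ends_conv)
    then show ?thesis
      using auto_pi that piW unfolding graph_automorphism_def W_def[symmetric]
      by auto
  qed
  have exchanged: "(x, y) \<in> parcs G2 \<longleftrightarrow> (\<pi> x, \<pi> y) \<in> parcs G1" if "x \<in> W" "y \<in> W" for x y
    using pi_G[OF that] map_edges_involution_iff[OF F_sub invW that]
    unfolding arcs1 arcs2 by blast
  have outside: "(x, y) \<in> parcs G1 \<longleftrightarrow> (x, y) \<in> parcs G" "(x, y) \<in> parcs G2 \<longleftrightarrow> (x, y) \<in> parcs G"
    if "\<not> (x \<in> W \<and> y \<in> W)" for x y
    using that F_sub piF_sub unfolding arcs1 arcs2 by blast+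

  obtain k where k: "\<And>x. x \<in> W \<Longrightarrow> card {y \<in> W. (x, y) \<in> parcs G1} = k"
    using regular out_degree_induced_eq_card
    unfolding regular_graph_def W_def[symmetric] by (metis induce_subgraph_verts)

  \<comment> \<open>The co-degree condition compares $N(u) \setminus V_2$ with $N(w) \setminus V_1$. As $G[V_1]$ and
    $G[V_2]$ have no edges, these are the neighbourhoods outside $V_1 \cup V_2$. The condition relates
    $V_1$ only to $V_2$; two vertices on the same side are compared through a third one on the
    other side.\<close>
  define outer where "outer x = card {y \<in> pverts G - W. (x, y) \<in> parcs G}" for x
  have nb1: "neighbours (with_proj G) u - V2 = {y \<in> pverts G - W. (u, y) \<in> parcs G}"
    if "u \<in> V1" for u
    using that empty1 pair_graph_parcs(1)[OF G] by (auto simp: neighbours_def W_def)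
  have nb2: "neighbours (with_proj G) w - V1 = {y \<in> pverts G - W. (w, y) \<in> parcs G}"
    if "w \<in> V2" for w
    using that empty2 pair_graph_parcs(1)[OF G] by (auto simp: neighbours_def W_def)
  have outer12: "outer u = outer w" if "u \<in> V1" "w \<in> V2" for u w
    using cousins that nb1[OF that(1)] nb2[OF that(2)]
    unfolding co_degree_cousins_def outer_def by metis
  obtain d where d: "\<And>x. x \<in> W \<Longrightarrow> outer x = d"
  proof (cases "V1 = {}")
    case True
    then have "W = {}" using swap1 by (simp add: W_def)
    then show ?thesis using that by blast
  next
    case False
    then obtain u where u: "u \<in> V1" by blast
    then have pu: "\<pi> u \<in> V2" using swap1 by blast
    have "outer x = outer u" if "x \<in> W" for x
      using that outer12[OF u] outer12[OF _ pu] outer12[OF u pu] by (auto simp: W_def)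
    then show ?thesis using that by blast
  qed

  interpret E: cousin_exchange "pverts G" V1 V2 \<pi> "adjacency G1" "adjacency G2" "real k" "real d"
  proof (unfold_locales, fold W_def)
    show "finite (pverts G)" by (rule G.pair_finite_verts)
    show "adjacency G1 x y = adjacency G1 y x" for x y
      using sym1 by (auto simp: adjacency_def sym_def)
    show "adjacency G2 x y = adjacency G1 (\<pi> x) (\<pi> y)" if "x \<in> W" "y \<in> W" for x y
      using exchanged[OF that] by (simp add: adjacency_def)
    show "adjacency G2 x y = adjacency G1 x y" if "\<not> (x \<in> W \<and> y \<in> W)" for x y
      using outside[OF that] by (simp add: adjacency_def)
    show "adjacency G1 x v = adjacency G1 y v" if "v \<in> pverts G - W" "x \<in> V1" "y \<in> V1" for v x y
    proof -
      have "(x, v) \<in> parcs G \<longleftrightarrow> (y, v) \<in> parcs G"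
        using that cousins unfolding co_degree_cousins_def W_def[symmetric] with_proj_simps by blast
      moreover have "v \<notin> W" using that by blast
      ultimately show ?thesis
        using outside(1)[of x v] outside(1)[of y v] by (simp add: adjacency_def)
    qed
    show "adjacency G1 x v = adjacency G1 y v" if "v \<in> pverts G - W" "x \<in> V2" "y \<in> V2" for v x y
    proof -
      have "(x, v) \<in> parcs G \<longleftrightarrow> (y, v) \<in> parcs G"
        using that cousins unfolding co_degree_cousins_def W_def[symmetric] with_proj_simps by blast
      moreover have "v \<notin> W" using that by blast
      ultimately show ?thesis
        using outside(1)[of x v] outside(1)[of y v] by (simp add: adjacency_def)
    qed
    show "(\<Sum>y\<in>W. adjacency G1 x y) = real k" if "x \<in> W" for x
      using k[OF that] by (simp add: sum_adjacency[OF finW])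
    show "(\<Sum>y\<in>pverts G - W. adjacency G1 x y) = real d" if "x \<in> W" for x
    proof -
      have "{y \<in> pverts G - W. (x, y) \<in> parcs G1} = {y \<in> pverts G - W. (x, y) \<in> parcs G}"
        using outside(1) by blast
      then show ?thesis
        using d[OF that] G.pair_finite_verts by (simp add: sum_adjacency outer_def)
    qed
  qed (use V1 V2 disj swap1 swap2 invW in auto)

  show ?thesis
    unfolding cospectral_def vertex_enumeration_def with_proj_simps
  proof (intro allI impI)
    fix vs ws
    assume vs: "distinct vs \<and> set vs = pverts G1" and ws: "distinct ws \<and> set ws = pverts G2"
    have fin: "finite (pverts G1)" "finite (pverts G2)"
      by (simp_all add: verts12 G.pair_finite_verts)
    have "similar_mat (kernel_mat vs vs (normalized_kernel (pverts G) (adjacency G1)))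
        (kernel_mat ws ws (normalized_kernel (pverts G) (adjacency G2)))"
      by (rule similar_kernel_mat[where V = "pverts G" and t = E.reflection])
        (use vs ws verts12 in \<open>simp_all add: E.reflection_involution
          E.reflection_intertwines_normalized\<close>)
    then show "eigenvalue_mset (normalized_laplacian (with_proj G1) vs) =
        eigenvalue_mset (normalized_laplacian (with_proj G2) ws)"
      using normalized_laplacian_eq_kernel_mat[OF fin(1) wf1, of vs]
        normalized_laplacian_eq_kernel_mat[OF fin(2) wf2, of ws] vs ws
      by (simp add: verts12 similar_mat_eigenvalue_mset)
  qed
qed

end
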